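(* Let $M$ be a real smooth manifold with an affine connection $\nabla$ with torsion $T$, and let $\mathfrak{X}_M$ be the real vector space of smooth vector fields on $M$, equipped with the product $X\rhd Y:=\nabla_XY$ and the bracket $[\![X,Y]\!]:=-T(X,Y)$. Then the connection algebra $(\mathfrak{X}_M,[\![\cdot,\cdot]\!],\rhd)$ is a post-Lie-Yamaguti algebra if and only if $(M,\nabla)$ can be represented as a locally reductive homogeneous space with its canonical connection.
   Context: Curvature and torsion: $R(X,Y)Z=\nabla_X\nabla_YZ-\nabla_Y\nabla_XZ-\nabla_{[X,Y]_J}Z$ and $T(X,Y)=\nabla_XY-\nabla_YX-[X,Y]_J$, where $[\cdot,\cdot]_J$ is the Jacobi–Lie bracket of vector fields. For a real vector space $\mathcal{A}$ with bilinear product $\rhd$, put $a_\rhd(x,y,z)=x\rhd(y\rhd z)-(x\rhd y)\rhd z$ and define the triple-bracket $[x,y,z]=a_\rhd(x,y,z)-a_\rhd(y,x,z)$. For $x,y,z\in\mathcal A$ write $(x\cdot y)\rhd z:=a_\rhd(x,y,z)$. With a further bilinear bracket $[\![\cdot,\cdot]\!]$, $\mathcal{A}$ is a post-Lie-Yamaguti algebra if for all $x,y,z,w\in\mathcal A$ (with $\sum_{\circlearrowleft}$ the sum over cyclic permutations of $(x,y,z)$): (i) $[\![x,x]\!]=0$; (ii) $w\rhd[\![x,y]\!]=[\![w\rhd x,y]\!]+[\![x,w\rhd y]\!]$; (iii) $w\rhd[x,y,z]=[w\rhd x,y,z]+[x,w\rhd y,z]+[x,y,w\rhd z]+(w\cdot[\![x,y]\!])\rhd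 z-[\![x,y]\!]\rhd(w\rhd z)$; (iv) $\sum_{\circlearrowleft}[x,y,z]=\sum_{\circlearrowleft}\left([\![[\![x,y]\!],z]\!]+[\![x,y]\!]\rhd z\right)$; (v) $\sum_{\circlearrowleft}[[\![x,y]\!],z,w]=\sum_{\circlearrowleft}[\![[\![x,y]\!],z]\!]\rhd w$. The canonical connection of a reductive homogeneous space $G/H$ (with $\mathfrak g=\mathfrak h\oplus\mathfrak m$, $\mathrm{Ad}(H)\mathfrak m\subset\mathfrak m$) is Nomizu's canonical affine connection of the second kind. By a theorem of Nomizu (1954, Theorem 18.1), which is used as the characterization of the local notion: $(M,\nabla)$ can be represented as a locally reductive homogeneous space with its canonical connection if and only if $\nabla R=0$ and $\nabla T=0$. *)

theory Defs
  imports "HOL-Analysis.Analysis" "HOL-Library.Function_Algebras"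
begin

instantiation "fun" :: (type, real_vector) real_vector
begin

definition scaleR_fun :: "real \<Rightarrow> ('a \<Rightarrow> 'b) \<Rightarrow> 'a \<Rightarrow> 'b" where
  "scaleR_fun c f = (\<lambda>x. c *\<^sub>R f x)"

instance
  by standard (auto simp: scaleR_fun_def fun_eq_iff algebra_simps)

end

section \<open>Smooth functions on open subsets of n-dimensional Euclidean space\<close>

definition partial_deriv :: "nat \<Rightarrow> ((nat \<Rightarrow> real) \<Rightarrow> real) \<Rightarrow> (nat \<Rightarrow> real) \<Rightarrow> real" where
  "partial_deriv i f x = deriv (\<lambda>t. f (x(i := t))) (x i)"

text \<open>Only the values of \<open>f\<close> on \<open>U\<close> matter, provided that \<open>U\<close> is open in \<open>Euclidean_space n\<close>.\<close>

fun Ck_on :: "nat \<Rightarrow> nat \<Rightarrow> (nat \<Rightarrow> real) set \<Rightarrow> ((nat \<Rightarrow> real) \<Rightarrow> real) \<Rightarrow> bool" where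
  "Ck_on n 0 U f \<longleftrightarrow>
     continuous_map (subtopology (Euclidean_space n) U) euclideanreal f"
| "Ck_on n (Suc k) U f \<longleftrightarrow>
     continuous_map (subtopology (Euclidean_space n) U) euclideanreal f \<and>
     (\<forall>i<n. (\<forall>x\<in>U. (\<lambda>t. f (x(i := t))) field_differentiable at (x i)) \<and>
            Ck_on n k U (partial_deriv i f))"

definition smooth_on :: "nat \<Rightarrow> (nat \<Rightarrow> real) set \<Rightarrow> ((nat \<Rightarrow> real) \<Rightarrow> real) \<Rightarrow> bool" where
  "smooth_on n U f \<longleftrightarrow> (\<forall>k. Ck_on n k U f)"

section \<open>Smooth manifolds\<close>

type_synonym 'a chart = "'a set \<times> ('a \<Rightarrow> nat \<Rightarrow> real)"

definition smooth_atlas :: "'a topology \<Rightarrow> nat \<Rightarrow> 'a chart set \<Rightarrow> bool" where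
  "smooth_atlas M n \<A> \<longleftrightarrow>
     (\<forall>(U, \<phi>)\<in>\<A>. openin M U \<and> openin (Euclidean_space n) (\<phi> ` U) \<and>
        homeomorphic_map (subtopology M U) (subtopology (Euclidean_space n) (\<phi> ` U)) \<phi>) \<and>
     (\<Union>(U, \<phi>)\<in>\<A>. U) = topspace M \<and>
     (\<forall>(U, \<phi>)\<in>\<A>. \<forall>(V, \<psi>)\<in>\<A>. \<forall>j<n.
        smooth_on n (\<phi> ` (U \<inter> V)) (\<lambda>x. \<psi> (inv_into U \<phi> x) j))"

text \<open>The atlas need not be maximal: enlarging it to a compatible one does not change the
  smooth functions, and hence changes none of the notions below.\<close>

definition smooth_manifold :: "'a topology \<Rightarrow> nat \<Rightarrow> 'a chart set \<Rightarrow> bool" where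
  "smooth_manifold M n \<A> \<longleftrightarrow>
     Hausdorff_space M \<and> second_countable M \<and> smooth_atlas M n \<A>"

text \<open>Functions on \<open>M\<close> are represented by their extension by \<open>0\<close> outside the point set of \<open>M\<close>,
  so that equality of functions on \<open>M\<close> is equality in HOL.\<close>

definition smooth_functions :: "'a topology \<Rightarrow> nat \<Rightarrow> 'a chart set \<Rightarrow> ('a \<Rightarrow> real) set" where
  "smooth_functions M n \<A> =
     {f. (\<forall>(U, \<phi>)\<in>\<A>. smooth_on n (\<phi> ` U) (\<lambda>x. f (inv_into U \<phi> x))) \<and>
         (\<forall>p. p \<notin> topspace M \<longrightarrow> f p = 0)}"

section \<open>Vector fields\<close>

text \<open>Tangent vectors at \<open>p\<close> are the derivations at \<open>p\<close> of the algebra of smooth functions; their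
  value on non-smooth arguments is fixed to \<open>0\<close> to make them unique as HOL functions.\<close>

definition tangent_space ::
  "'a topology \<Rightarrow> nat \<Rightarrow> 'a chart set \<Rightarrow> 'a \<Rightarrow> (('a \<Rightarrow> real) \<Rightarrow> real) set" where
  "tangent_space M n \<A> p =
     {v. (\<forall>f\<in>smooth_functions M n \<A>. \<forall>g\<in>smooth_functions M n \<A>.
            v (f + g) = v f + v g \<and> v (f * g) = f p * v g + g p * v f) \<and>
         (\<forall>c. \<forall>f\<in>smooth_functions M n \<A>. v (c *\<^sub>R f) = c * v f) \<and>
         (\<forall>f. f \<notin> smooth_functions M n \<A> \<longrightarrow> v f = 0)}"

type_synonym 'a vfield = "'a \<Rightarrow> ('a \<Rightarrow> real) \<Rightarrow> real"

definition vf_apply :: "'a vfield \<Rightarrow> ('a \<Rightarrow> real) \<Rightarrow> 'a \<Rightarrow> real" where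
  "vf_apply X f = (\<lambda>p. X p f)"

definition vf_mult :: "('a \<Rightarrow> real) \<Rightarrow> 'a vfield \<Rightarrow> 'a vfield" where
  "vf_mult f X = (\<lambda>p. f p *\<^sub>R X p)"

definition vector_fields :: "'a topology \<Rightarrow> nat \<Rightarrow> 'a chart set \<Rightarrow> 'a vfield set" where
  "vector_fields M n \<A> =
     {X. (\<forall>p\<in>topspace M. X p \<in> tangent_space M n \<A> p) \<and>
         (\<forall>f\<in>smooth_functions M n \<A>. vf_apply X f \<in> smooth_functions M n \<A>) \<and>
         (\<forall>p. p \<notin> topspace M \<longrightarrow> X p = 0)}"

definition lie_bracket :: "'a vfield \<Rightarrow> 'a vfield \<Rightarrow> 'a vfield" where
  "lie_bracket X Y = (\<lambda>p f. X p (vf_apply Y f) - Y p (vf_apply X f))"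

section \<open>Affine connections\<close>

definition affine_connection ::
  "'a topology \<Rightarrow> nat \<Rightarrow> 'a chart set \<Rightarrow> ('a vfield \<Rightarrow> 'a vfield \<Rightarrow> 'a vfield) \<Rightarrow> bool" where
  "affine_connection M n \<A> nabla \<longleftrightarrow>
     (\<forall>X\<in>vector_fields M n \<A>. \<forall>Y\<in>vector_fields M n \<A>.
        nabla X Y \<in> vector_fields M n \<A> \<and>
        (\<forall>Z\<in>vector_fields M n \<A>.
           nabla (X + Y) Z = nabla X Z + nabla Y Z \<and>
           nabla X (Y + Z) = nabla X Y + nabla X Z) \<and>
        (\<forall>c. nabla X (c *\<^sub>R Y) = c *\<^sub>R nabla X Y) \<and>
        (\<forall>f\<in>smooth_functions M n \<A>.
           nabla (vf_mult f X) Y = vf_mult f (nabla X Y) \<and>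
           nabla X (vf_mult f Y) = vf_mult (vf_apply X f) Y + vf_mult f (nabla X Y)))"

definition torsion ::
  "('a vfield \<Rightarrow> 'a vfield \<Rightarrow> 'a vfield) \<Rightarrow> 'a vfield \<Rightarrow> 'a vfield \<Rightarrow> 'a vfield" where
  "torsion nabla X Y = nabla X Y - nabla Y X - lie_bracket X Y"

definition curvature ::
  "('a vfield \<Rightarrow> 'a vfield \<Rightarrow> 'a vfield) \<Rightarrow> 'a vfield \<Rightarrow> 'a vfield \<Rightarrow> 'a vfield \<Rightarrow> 'a vfield" where
  "curvature nabla X Y Z = nabla X (nabla Y Z) - nabla Y (nabla X Z) - nabla (lie_bracket X Y) Z"

text \<open>The covariant derivatives of the tensor fields \<open>T\<close> and \<open>R\<close> in the direction of \<open>W\<close>.\<close>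

definition nabla_torsion ::
  "('a vfield \<Rightarrow> 'a vfield \<Rightarrow> 'a vfield) \<Rightarrow> 'a vfield \<Rightarrow> 'a vfield \<Rightarrow> 'a vfield \<Rightarrow> 'a vfield" where
  "nabla_torsion nabla W X Y =
     nabla W (torsion nabla X Y) - torsion nabla (nabla W X) Y - torsion nabla X (nabla W Y)"

definition nabla_curvature ::
  "('a vfield \<Rightarrow> 'a vfield \<Rightarrow> 'a vfield) \<Rightarrow>
     'a vfield \<Rightarrow> 'a vfield \<Rightarrow> 'a vfield \<Rightarrow> 'a vfield \<Rightarrow> 'a vfield" where
  "nabla_curvature nabla W X Y Z =
     nabla W (curvature nabla X Y Z) - curvature nabla (nabla W X) Y Z - curvature nabla X (nabla W Y) Z
       - curvature nabla X Y (nabla W Z)"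

text \<open>\<open>(M, nabla)\<close> can be represented as a locally reductive homogeneous space with its canonical
  connection (Nomizu's canonical affine connection of the second kind).  The notion is rendered
  by Nomizu's characterization (Invariant affine connections on homogeneous spaces, Amer. J.
  Math. 76 (1954), Theorem 18.1): curvature and torsion are parallel, \<open>\<nabla>R = 0\<close> and \<open>\<nabla>T = 0\<close>.\<close>

definition locally_reductive_homogeneous ::
  "'a topology \<Rightarrow> nat \<Rightarrow> 'a chart set \<Rightarrow> ('a vfield \<Rightarrow> 'a vfield \<Rightarrow> 'a vfield) \<Rightarrow> bool" where
  "locally_reductive_homogeneous M n \<A> nabla \<longleftrightarrow>
     (\<forall>W\<in>vector_fields M n \<A>. \<forall>X\<in>vector_fields M n \<A>.
      \<forall>Y\<in>vector_fields M n \<A>. \<forall>Z\<in>vector_fields M n \<A>.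
        nabla_curvature nabla W X Y Z = 0) \<and>
     (\<forall>W\<in>vector_fields M n \<A>. \<forall>X\<in>vector_fields M n \<A>. \<forall>Y\<in>vector_fields M n \<A>.
        nabla_torsion nabla W X Y = 0)"

section \<open>Post-Lie-Yamaguti algebras\<close>

definition associator :: "('v \<Rightarrow> 'v \<Rightarrow> 'v) \<Rightarrow> 'v \<Rightarrow> 'v \<Rightarrow> 'v \<Rightarrow> 'v::real_vector" where
  "associator tri x y z = tri x (tri y z) - tri (tri x y) z"

definition triple_bracket :: "('v \<Rightarrow> 'v \<Rightarrow> 'v) \<Rightarrow> 'v \<Rightarrow> 'v \<Rightarrow> 'v \<Rightarrow> 'v::real_vector" where
  "triple_bracket tri x y z = associator tri x y z - associator tri y x z"

definition bilinear_product_on :: "'v::real_vector set \<Rightarrow> ('v \<Rightarrow> 'v \<Rightarrow> 'v) \<Rightarrow> bool" where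
  "bilinear_product_on A m \<longleftrightarrow>
     (\<forall>x\<in>A. \<forall>y\<in>A. m x y \<in> A \<and>
        (\<forall>z\<in>A. m (x + y) z = m x z + m y z \<and> m x (y + z) = m x y + m x z) \<and>
        (\<forall>c. m (c *\<^sub>R x) y = c *\<^sub>R m x y \<and> m x (c *\<^sub>R y) = c *\<^sub>R m x y))"

definition cyclic_sum :: "('v \<Rightarrow> 'v \<Rightarrow> 'v \<Rightarrow> 'v) \<Rightarrow> 'v \<Rightarrow> 'v \<Rightarrow> 'v \<Rightarrow> 'v::real_vector" where
  "cyclic_sum F x y z = F x y z + F y z x + F z x y"

text \<open>The carrier \<open>A\<close> is a subspace of the ambient type, with bracket \<open>br\<close> and product \<open>tri\<close>.
  In the third axiom, \<open>associator tri w (br x y) z\<close> is the action of \<open>w \<cdot> br x y\<close> on \<open>z\<close>.\<close>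

definition post_Lie_Yamaguti_algebra ::
  "'v::real_vector set \<Rightarrow> ('v \<Rightarrow> 'v \<Rightarrow> 'v) \<Rightarrow> ('v \<Rightarrow> 'v \<Rightarrow> 'v) \<Rightarrow> bool" where
  "post_Lie_Yamaguti_algebra A br tri \<longleftrightarrow>
     subspace A \<and> bilinear_product_on A br \<and> bilinear_product_on A tri \<and>
     (\<forall>x\<in>A. br x x = 0) \<and>
     (\<forall>x\<in>A. \<forall>y\<in>A. \<forall>w\<in>A. tri w (br x y) = br (tri w x) y + br x (tri w y)) \<and>
     (\<forall>x\<in>A. \<forall>y\<in>A. \<forall>z\<in>A. \<forall>w\<in>A.
        tri w (triple_bracket tri x y z) =
          triple_bracket tri (tri w x) y z + triple_bracket tri x (tri w y) z
          + triple_bracket tri x y (tri w z)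
          + associator tri w (br x y) z - tri (br x y) (tri w z)) \<and>
     (\<forall>x\<in>A. \<forall>y\<in>A. \<forall>z\<in>A.
        cyclic_sum (\<lambda>x y z. triple_bracket tri x y z) x y z =
        cyclic_sum (\<lambda>x y z. br (br x y) z + tri (br x y) z) x y z) \<and>
     (\<forall>x\<in>A. \<forall>y\<in>A. \<forall>z\<in>A. \<forall>w\<in>A.
        cyclic_sum (\<lambda>x y z. triple_bracket tri (br x y) z w) x y z =
        cyclic_sum (\<lambda>x y z. tri (br (br x y) z) w) x y z)"

end

theory Submission
  imports Defs
begin

text \<open>
  With \<open>B = - T\<close> the triple bracket is \<open>[X,Y,Z] = R(X,Y)Z + \<nabla>\<^bsub>B(X,Y)\<^esub>Z\<close>. Hence axiom (ii) is
  \<open>\<nabla>T = 0\<close> and, in its presence, (iii) is \<open>\<nabla>R = 0\<close>. Axioms (iv) and (v) become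
  \<open>\<Sum> R(X,Y)Z = \<Sum> T(T(X,Y),Z)\<close> and \<open>\<Sum> R(T(X,Y),Z) = 0\<close>, which are the two Bianchi identities
  for parallel \<open>T\<close> and \<open>R\<close>.
\<close>

section \<open>The algebra of smooth functions\<close>

text \<open>The coordinate line through \<open>x\<close> is continuous into
  \<open>Euclidean_space n\<close>, so the preimage of \<open>U\<close> is open. This is what makes
  \<open>partial_deriv\<close> at points of \<open>U\<close> depend only on the values on
  \<open>U\<close>.\<close>

lemma eventually_fun_upd_in_openin_Euclidean_space:
  assumes "openin (Euclidean_space n) U" "x \<in> U" "i < n"
  shows "eventually (\<lambda>t. x(i := t) \<in> U) (nhds (x i))"
proof -
  \<comment> \<open>Points of \<open>Euclidean_space n\<close> are sequences vanishing from index
    \<open>n\<close> on; with \<open>i < n\<close>, changing coordinate \<open>i\<close> therefore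
    stays inside the space.\<close>
  have x0: "x j = 0" if "j \<ge> n" for j
    using openin_subset[OF assms(1)] assms(2) that by (auto simp: topspace_Euclidean_space)
  have "continuous_map euclideanreal (powertop_real UNIV) (\<lambda>t. x(i := t))"
    by (auto simp: continuous_map_componentwise_UNIV fun_upd_def)
  then have "continuous_map euclideanreal (Euclidean_space n) (\<lambda>t. x(i := t))"
    using assms(3) x0 by (auto simp: Euclidean_space_def continuous_map_in_subtopology)
  from openin_continuous_map_preimage[OF this assms(1)]
  have "open {t. x(i := t) \<in> U}" by simp
  then show ?thesis
    using assms(2) eventually_nhds_in_open[of "{t. x(i := t) \<in> U}" "x i"] by simp
qed

text \<open>Derivatives are local, so agreement on the open set \<open>U\<close> passes to all
  partial derivatives. Below, it replaces a partial derivative by a formula that is valid on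
  \<open>U\<close> only.\<close>

lemma Ck_on_cong:
  assumes "openin (Euclidean_space n) U"
  shows "(\<And>x. x \<in> U \<Longrightarrow> f x = g x) \<Longrightarrow> Ck_on n k U f \<Longrightarrow> Ck_on n k U g"
proof (induction k arbitrary: f g)
  case 0
  then show ?case by (auto elim!: continuous_map_eq)
next
  case (Suc k)
  have ev: "eventually (\<lambda>t. f (x(i := t)) = g (x(i := t))) (nhds (x i))" if "x \<in> U" "i < n" for x i
    using eventually_fun_upd_in_openin_Euclidean_space[OF assms that]
    by eventually_elim (use Suc.prems(1) in auto)
  have pd: "partial_deriv i f x = partial_deriv i g x" if "x \<in> U" "i < n" for x i
    unfolding partial_deriv_def by (rule deriv_cong_ev[OF ev[OF that] refl])
  have diff: "(\<lambda>t. g (x(i := t))) field_differentiable at (x i)" if "x \<in> U" "i < n" for x i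
  proof -
    have "(\<lambda>t. f (x(i := t))) field_differentiable at (x i)"
      using Suc.prems(2) that by auto
    then obtain D where "((\<lambda>t. f (x(i := t))) has_field_derivative D) (at (x i))"
      by (auto simp: field_differentiable_def)
    then have "((\<lambda>t. g (x(i := t))) has_field_derivative D) (at (x i))"
      using DERIV_cong_ev[OF refl ev[OF that] refl] by simp
    then show ?thesis by (auto simp: field_differentiable_def)
  qed
  have "Ck_on n k U (partial_deriv i g)" if "i < n" for i
    using Suc.IH[of "partial_deriv i f" "partial_deriv i g"] pd[OF _ that] Suc.prems(2) that by auto
  moreover have "continuous_map (subtopology (Euclidean_space n) U) euclideanreal g"
    using Suc.prems by (auto elim!: continuous_map_eq)
  ultimately show ?case using diff by auto
qed

section \<open>C^k functions on an open set: constants, sums and products\<close>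

lemma Ck_on_Suc_imp_Ck_on: "Ck_on n (Suc k) U f \<Longrightarrow> Ck_on n k U f"
proof (induction k arbitrary: f)
  case (Suc k)
  then show ?case by (metis Ck_on.simps(2))
qed simp

lemma Ck_on_const: "Ck_on n k U (\<lambda>x. c)"
proof (induction k arbitrary: c)
  case (Suc k)
  have "partial_deriv i (\<lambda>x. c) = (\<lambda>x. 0)" for i
    by (simp add: partial_deriv_def fun_eq_iff)
  with Suc show ?case by simp
qed simp

lemma Ck_on_add:
  assumes "openin (Euclidean_space n) U"
  shows "Ck_on n k U f \<Longrightarrow> Ck_on n k U g \<Longrightarrow> Ck_on n k U (\<lambda>x. f x + g x)"
proof (induction k arbitrary: f g)
  case 0
  then show ?case by (auto intro: continuous_map_add)
next
  case (Suc k)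
  have "Ck_on n k U (partial_deriv i (\<lambda>x. f x + g x))" if "i < n" for i
  proof (rule Ck_on_cong[OF assms])
    show "Ck_on n k U (\<lambda>x. partial_deriv i f x + partial_deriv i g x)"
      using Suc that by auto
    show "partial_deriv i f x + partial_deriv i g x = partial_deriv i (\<lambda>x. f x + g x) x"
      if "x \<in> U" for x
      unfolding partial_deriv_def using Suc.prems that \<open>i < n\<close> by simp
  qed
  then show ?case
    using Suc.prems by (auto intro!: continuous_map_add field_differentiable_add)
qed

lemma Ck_on_mult:
  assumes "openin (Euclidean_space n) U"
  shows "Ck_on n k U f \<Longrightarrow> Ck_on n k U g \<Longrightarrow> Ck_on n k U (\<lambda>x. f x * g x)"
proof (induction k arbitrary: f g)
  case 0
  then show ?case by (auto intro: continuous_map_real_mult)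
next
  case (Suc k)
  have "Ck_on n k U (partial_deriv i (\<lambda>x. f x * g x))" if "i < n" for i
  proof (rule Ck_on_cong[OF assms])
    \<comment> \<open>The Leibniz formula also contains \<open>f\<close> and \<open>g\<close>
      themselves. They are lowered from class \<open>Suc k\<close> to class \<open>k\<close>, so
      that the induction hypothesis covers both products.\<close>
    have "Ck_on n k U (partial_deriv i f)" "Ck_on n k U (partial_deriv i g)"
      using Suc.prems that by simp_all
    then show "Ck_on n k U (\<lambda>x. f x * partial_deriv i g x + partial_deriv i f x * g x)"
      by (intro Ck_on_add[OF assms Suc.IH Suc.IH] Suc.prems[THEN Ck_on_Suc_imp_Ck_on])
    show "f x * partial_deriv i g x + partial_deriv i f x * g x = partial_deriv i (\<lambda>x. f x * g x) x"
      if "x \<in> U" for x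
      unfolding partial_deriv_def using Suc.prems that \<open>i < n\<close> by simp
  qed
  then show ?case
    using Suc.prems by (auto intro!: continuous_map_real_mult field_differentiable_mult)
qed

section \<open>Smooth functions on a space with a smooth atlas\<close>

locale atlas =
  fixes M :: "'a topology" and n :: nat and \<A> :: "'a chart set"
  assumes smooth_atlas: "smooth_atlas M n \<A>"
begin

abbreviation "C \<equiv> smooth_functions M n \<A>"
abbreviation "V \<equiv> vector_fields M n \<A>"

lemma smooth_functionsI:
  assumes "\<And>U \<phi> k. (U, \<phi>) \<in> \<A> \<Longrightarrow> Ck_on n k (\<phi> ` U) (\<lambda>x. f (inv_into U \<phi> x))"
    and "\<And>p. p \<notin> topspace M \<Longrightarrow> f p = 0"
  shows "f \<in> C"
  using assms by (auto simp: smooth_functions_def smooth_on_def)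

lemma smooth_functionsD:
  assumes "f \<in> C"
  shows "(U, \<phi>) \<in> \<A> \<Longrightarrow> Ck_on n k (\<phi> ` U) (\<lambda>x. f (inv_into U \<phi> x))"
    and "p \<notin> topspace M \<Longrightarrow> f p = 0"
  using assms by (auto simp: smooth_functions_def smooth_on_def)

lemma chart_image_openin: "(U, \<phi>) \<in> \<A> \<Longrightarrow> openin (Euclidean_space n) (\<phi> ` U)"
  using smooth_atlas by (auto simp: smooth_atlas_def)

lemma chart_domain_subset: "(U, \<phi>) \<in> \<A> \<Longrightarrow> U \<subseteq> topspace M"
  using smooth_atlas by (auto simp: smooth_atlas_def dest!: openin_subset)

text \<open>Elements of \<open>C\<close> vanish off \<open>M\<close>, so the constant is cut off
  there. Multiplication by it realizes real scaling inside the ring \<open>C\<close>.\<close>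

definition const_function :: "real \<Rightarrow> 'a \<Rightarrow> real" where
  "const_function c = (\<lambda>p. if p \<in> topspace M then c else 0)"

lemma const_function_in_smooth: "const_function c \<in> C"
proof (rule smooth_functionsI)
  show "Ck_on n k (\<phi> ` U) (\<lambda>x. const_function c (inv_into U \<phi> x))" if "(U, \<phi>) \<in> \<A>" for U \<phi> k
  proof (rule Ck_on_cong[OF chart_image_openin[OF that] _ Ck_on_const[where c = c]])
    fix x assume "x \<in> \<phi> ` U"
    then have "inv_into U \<phi> x \<in> topspace M"
      by (rule subsetD[OF chart_domain_subset[OF that] inv_into_into])
    then show "c = const_function c (inv_into U \<phi> x)" by (simp add: const_function_def)
  qed
qed (simp add: const_function_def)

lemma add_in_smooth:
  assumes "f \<in> C" "g \<in> C"
  shows "f + g \<in> C"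
proof (rule smooth_functionsI)
  show "Ck_on n k (\<phi> ` U) (\<lambda>x. (f + g) (inv_into U \<phi> x))" if "(U, \<phi>) \<in> \<A>" for U \<phi> k
    unfolding plus_fun_apply
    by (rule Ck_on_add[OF chart_image_openin[OF that] assms[THEN smooth_functionsD(1), OF that]])
qed (simp add: assms[THEN smooth_functionsD(2)])

lemma mult_in_smooth:
  assumes "f \<in> C" "g \<in> C"
  shows "f * g \<in> C"
proof (rule smooth_functionsI)
  show "Ck_on n k (\<phi> ` U) (\<lambda>x. (f * g) (inv_into U \<phi> x))" if "(U, \<phi>) \<in> \<A>" for U \<phi> k
    unfolding times_fun_apply
    by (rule Ck_on_mult[OF chart_image_openin[OF that] assms[THEN smooth_functionsD(1), OF that]])
qed (simp add: assms[THEN smooth_functionsD(2)])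

lemma zero_in_smooth: "0 \<in> C"
proof -
  have "const_function 0 = 0" by (auto simp: const_function_def)
  then show ?thesis using const_function_in_smooth[of 0] by simp
qed

lemma scaleR_in_smooth:
  assumes "f \<in> C"
  shows "c *\<^sub>R f \<in> C"
proof -
  have "c *\<^sub>R f = const_function c * f"
    using assms by (auto simp: smooth_functions_def const_function_def scaleR_fun_def)
  then show ?thesis by (simp only: mult_in_smooth const_function_in_smooth assms)
qed

lemma diff_in_smooth:
  assumes "f \<in> C" "g \<in> C"
  shows "f - g \<in> C"
proof -
  have "f - g = f + (-1) *\<^sub>R g" by (auto simp: scaleR_fun_def)
  then show ?thesis by (simp only: add_in_smooth scaleR_in_smooth assms)
qed

section \<open>The Lie algebra of vector fields\<close>

lemma vf_apply_in_smooth: "X \<in> V \<Longrightarrow> f \<in> C \<Longrightarrow> vf_apply X f \<in> C"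
  by (simp add: vector_fields_def)

text \<open>On \<open>M\<close> this is the default value built into \<open>tangent_space\<close>;
  off \<open>M\<close> the field itself is zero.\<close>

lemma vf_apply_non_smooth:
  assumes "X \<in> V" "f \<notin> C"
  shows "vf_apply X f = 0"
proof
  fix p
  show "vf_apply X f p = 0 p"
    using assms by (cases "p \<in> topspace M") (auto simp: vector_fields_def tangent_space_def vf_apply_def)
qed

lemma vf_apply_add:
  assumes "X \<in> V" "f \<in> C" "g \<in> C"
  shows "vf_apply X (f + g) = vf_apply X f + vf_apply X g"
proof
  fix p
  show "vf_apply X (f + g) p = (vf_apply X f + vf_apply X g) p"
    using assms by (cases "p \<in> topspace M") (auto simp: vector_fields_def tangent_space_def vf_apply_def)
qed

lemma vf_apply_mult:
  assumes "X \<in> V" "f \<in> C" "g \<in> C"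
  shows "vf_apply X (f * g) = f * vf_apply X g + g * vf_apply X f"
proof
  fix p
  show "vf_apply X (f * g) p = (f * vf_apply X g + g * vf_apply X f) p"
    using assms by (cases "p \<in> topspace M") (auto simp: vector_fields_def tangent_space_def vf_apply_def)
qed

lemma vf_apply_scaleR:
  assumes "X \<in> V" "f \<in> C"
  shows "vf_apply X (c *\<^sub>R f) = c *\<^sub>R vf_apply X f"
proof
  fix p
  show "vf_apply X (c *\<^sub>R f) p = (c *\<^sub>R vf_apply X f) p"
    using assms by (cases "p \<in> topspace M")
      (auto simp: vector_fields_def tangent_space_def vf_apply_def scaleR_fun_def)
qed

lemma vf_apply_diff:
  assumes "X \<in> V" "f \<in> C" "g \<in> C"
  shows "vf_apply X (f - g) = vf_apply X f - vf_apply X g"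
proof -
  have "vf_apply X f = vf_apply X (f - g) + vf_apply X g"
    using vf_apply_add[OF assms(1) diff_in_smooth[OF assms(2,3)] assms(3)] by simp
  then show ?thesis by simp
qed

lemma vf_apply_zero: "X \<in> V \<Longrightarrow> vf_apply X 0 = 0"
  using vf_apply_diff[of X 0 0] zero_in_smooth by simp

text \<open>A derivation of the algebra \<open>C\<close> is a vector field: the tangent vector
  conditions at a point are the derivation laws evaluated there.\<close>

lemma vector_fieldI:
  assumes "\<And>f. f \<in> C \<Longrightarrow> vf_apply X f \<in> C"
    and "\<And>f. f \<notin> C \<Longrightarrow> vf_apply X f = 0"
    and "\<And>f g. f \<in> C \<Longrightarrow> g \<in> C \<Longrightarrow> vf_apply X (f + g) = vf_apply X f + vf_apply X g"
    and "\<And>f g. f \<in> C \<Longrightarrow> g \<in> C \<Longrightarrow> vf_apply X (f * g) = f * vf_apply X g + g * vf_apply X f"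
    and "\<And>c f. f \<in> C \<Longrightarrow> vf_apply X (c *\<^sub>R f) = c *\<^sub>R vf_apply X f"
  shows "X \<in> V"
proof -
  \<comment> \<open>Vanishing off \<open>M\<close> is automatic: the image of a smooth function lies
    in \<open>C\<close>, whose elements vanish there, and every other image is zero.\<close>
  have "X p f = 0" if "p \<notin> topspace M" for p f
    using assms(1,2)[of f] that
    by (cases "f \<in> C") (auto simp: smooth_functions_def vf_apply_def fun_eq_iff)
  then show ?thesis
    using assms
    by (auto simp: vector_fields_def tangent_space_def vf_apply_def fun_eq_iff scaleR_fun_def)
qed

text \<open>Both fields are zero on non-smooth arguments, so smooth test functions decide equality.
  Bracket identities thereby become identities between operators on \<open>C\<close>.\<close>

lemma vector_field_eqI:
  assumes "X \<in> V" "Y \<in> V" "\<And>f. f \<in> C \<Longrightarrow> vf_apply X f = vf_apply Y f"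
  shows "X = Y"
proof (intro ext)
  fix p f
  have "vf_apply X f = vf_apply Y f"
    using assms vf_apply_non_smooth by (cases "f \<in> C") auto
  then show "X p f = Y p f" by (simp add: vf_apply_def fun_eq_iff)
qed

lemma vf_apply_simps:
  "vf_apply 0 f = 0"
  "vf_apply (X + Y) f = vf_apply X f + vf_apply Y f"
  "vf_apply (X - Y) f = vf_apply X f - vf_apply Y f"
  "vf_apply (c *\<^sub>R X) f = c *\<^sub>R vf_apply X f"
  "vf_apply (lie_bracket X Y) f = vf_apply X (vf_apply Y f) - vf_apply Y (vf_apply X f)"
  by (auto simp: vf_apply_def scaleR_fun_def lie_bracket_def)

lemma subspace_vector_fields: "subspace V"
proof (rule subspaceI)
  show "0 \<in> V"
    by (rule vector_fieldI) (auto simp: vf_apply_simps zero_in_smooth)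
  show "X + Y \<in> V" if "X \<in> V" "Y \<in> V" for X Y
    by (rule vector_fieldI)
      (use that in \<open>auto simp: vf_apply_simps vf_apply_in_smooth vf_apply_non_smooth vf_apply_add
         vf_apply_mult vf_apply_scaleR add_in_smooth algebra_simps\<close>)
  show "c *\<^sub>R X \<in> V" if "X \<in> V" for c X
  proof (rule vector_fieldI)
    show "vf_apply (c *\<^sub>R X) (f * g) = f * vf_apply (c *\<^sub>R X) g + g * vf_apply (c *\<^sub>R X) f"
      if "f \<in> C" "g \<in> C" for f g
      unfolding vf_apply_simps vf_apply_mult[OF \<open>X \<in> V\<close> that]
      by (auto simp: scaleR_fun_def algebra_simps)
  qed (use that in \<open>auto simp: vf_apply_simps vf_apply_in_smooth vf_apply_non_smooth vf_apply_add
         vf_apply_scaleR scaleR_in_smooth algebra_simps\<close>)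
qed

text \<open>The commutator of two derivations is a derivation: in the expansion on
  \<open>f * g\<close> the mixed first-order terms are symmetric in \<open>X\<close> and
  \<open>Y\<close> and cancel.\<close>

lemma lie_bracket_in_vector_fields:
  assumes "X \<in> V" "Y \<in> V"
  shows "lie_bracket X Y \<in> V"
  by (rule vector_fieldI)
    (use assms in \<open>auto simp: vf_apply_simps vf_apply_in_smooth vf_apply_non_smooth vf_apply_zero
       vf_apply_add vf_apply_mult vf_apply_scaleR mult_in_smooth diff_in_smooth algebra_simps\<close>)

lemma lie_bracket_skew: "lie_bracket Y X = - lie_bracket X Y"
  by (simp add: lie_bracket_def fun_eq_iff)

lemma lie_bracket_add_right:
  assumes "X \<in> V" "Y \<in> V" "Z \<in> V"
  shows "lie_bracket X (Y + Z) = lie_bracket X Y + lie_bracket X Z"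
  by (rule vector_field_eqI)
    (use assms subspace_add[OF subspace_vector_fields] in \<open>auto simp: vf_apply_simps
       lie_bracket_in_vector_fields vf_apply_in_smooth vf_apply_add\<close>)

lemma lie_bracket_scaleR_right:
  assumes "X \<in> V" "Y \<in> V"
  shows "lie_bracket X (c *\<^sub>R Y) = c *\<^sub>R lie_bracket X Y"
  by (rule vector_field_eqI)
    (use assms subspace_scale[OF subspace_vector_fields] in \<open>auto simp: vf_apply_simps
       lie_bracket_in_vector_fields vf_apply_in_smooth vf_apply_scaleR algebra_simps\<close>)

text \<open>As operators on \<open>C\<close>, the three double commutators expand into twelve
  threefold composites that cancel in pairs.\<close>

lemma lie_bracket_jacobi:
  assumes "X \<in> V" "Y \<in> V" "Z \<in> V"
  shows "lie_bracket (lie_bracket X Y) Z + lie_bracket (lie_bracket Y Z) X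
    + lie_bracket (lie_bracket Z X) Y = 0"
  by (rule vector_field_eqI)
    (use assms subspace_add[OF subspace_vector_fields] subspace_0[OF subspace_vector_fields]
      in \<open>auto simp: vf_apply_simps lie_bracket_in_vector_fields vf_apply_in_smooth vf_apply_diff\<close>)

end

section \<open>Linearity rules for the connection, its torsion and its curvature\<close>

locale manifold_connection = atlas M n \<A> for M :: "'a topology" and n \<A> +
  fixes nabla :: "'a vfield \<Rightarrow> 'a vfield \<Rightarrow> 'a vfield"
  assumes affine_connection: "affine_connection M n \<A> nabla"
begin

abbreviation "L \<equiv> lie_bracket"
abbreviation "T \<equiv> torsion nabla"
abbreviation "R \<equiv> curvature nabla"

lemmas add_in_V = subspace_add[OF subspace_vector_fields]
lemmas diff_in_V = subspace_diff[OF subspace_vector_fields]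
lemmas neg_in_V = subspace_neg[OF subspace_vector_fields]

lemma nabla_in_V: "X \<in> V \<Longrightarrow> Y \<in> V \<Longrightarrow> nabla X Y \<in> V"
  using affine_connection by (simp add: affine_connection_def)

lemma nabla_add_left: "X \<in> V \<Longrightarrow> Y \<in> V \<Longrightarrow> Z \<in> V \<Longrightarrow> nabla (X + Y) Z = nabla X Z + nabla Y Z"
  using affine_connection by (simp add: affine_connection_def)

lemma nabla_add_right: "X \<in> V \<Longrightarrow> Y \<in> V \<Longrightarrow> Z \<in> V \<Longrightarrow> nabla X (Y + Z) = nabla X Y + nabla X Z"
  using affine_connection by (simp add: affine_connection_def)

lemma nabla_scaleR_right: "X \<in> V \<Longrightarrow> Y \<in> V \<Longrightarrow> nabla X (c *\<^sub>R Y) = c *\<^sub>R nabla X Y"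
  using affine_connection by (simp add: affine_connection_def)

lemma vf_mult_const_function: "X \<in> V \<Longrightarrow> vf_mult (const_function c) X = c *\<^sub>R X"
  by (rule ext) (auto simp: vf_mult_def const_function_def scaleR_fun_def vector_fields_def)

text \<open>Real homogeneity in the direction is the case of a constant function in linearity over
  \<open>C\<close>.\<close>

lemma nabla_scaleR_left:
  assumes "X \<in> V" "Y \<in> V"
  shows "nabla (c *\<^sub>R X) Y = c *\<^sub>R nabla X Y"
proof -
  have "nabla (vf_mult (const_function c) X) Y = vf_mult (const_function c) (nabla X Y)"
    using affine_connection assms const_function_in_smooth by (simp add: affine_connection_def)
  then show ?thesis using assms by (simp add: vf_mult_const_function nabla_in_V)
qed

lemma nabla_diff_left:
  assumes "X \<in> V" "Y \<in> V" "Z \<in> V"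
  shows "nabla (X - Y) Z = nabla X Z - nabla Y Z"
  using nabla_add_left[of "X - Y" Y Z] assms diff_in_V by simp

lemma nabla_diff_right:
  assumes "X \<in> V" "Y \<in> V" "Z \<in> V"
  shows "nabla X (Y - Z) = nabla X Y - nabla X Z"
  using nabla_add_right[of X "Y - Z" Z] assms diff_in_V by simp

lemma nabla_neg_left: "X \<in> V \<Longrightarrow> Y \<in> V \<Longrightarrow> nabla (- X) Y = - nabla X Y"
  using nabla_scaleR_left[of X Y "-1"] by simp

lemma nabla_neg_right: "X \<in> V \<Longrightarrow> Y \<in> V \<Longrightarrow> nabla X (- Y) = - nabla X Y"
  using nabla_scaleR_right[of X Y "-1"] by simp

lemma lie_bracket_add_left:
  "X \<in> V \<Longrightarrow> Y \<in> V \<Longrightarrow> Z \<in> V \<Longrightarrow> L (X + Y) Z = L X Z + L Y Z"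
  using lie_bracket_add_right[of Z X Y] by (simp add: lie_bracket_skew[of _ Z])

lemma lie_bracket_scaleR_left: "X \<in> V \<Longrightarrow> Y \<in> V \<Longrightarrow> L (c *\<^sub>R X) Y = c *\<^sub>R L X Y"
  using lie_bracket_scaleR_right[of Y X c] by (simp add: lie_bracket_skew[of _ Y])

lemma lie_bracket_diff_left:
  assumes "X \<in> V" "Y \<in> V" "Z \<in> V"
  shows "L (X - Y) Z = L X Z - L Y Z"
  using lie_bracket_add_left[of "X - Y" Y Z] assms diff_in_V by simp

lemma torsion_in_V: "X \<in> V \<Longrightarrow> Y \<in> V \<Longrightarrow> T X Y \<in> V"
  by (simp add: torsion_def diff_in_V nabla_in_V lie_bracket_in_vector_fields)

lemma curvature_in_V: "X \<in> V \<Longrightarrow> Y \<in> V \<Longrightarrow> Z \<in> V \<Longrightarrow> R X Y Z \<in> V"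
  by (simp add: curvature_def diff_in_V nabla_in_V lie_bracket_in_vector_fields)

lemma bilinear_nabla: "bilinear_product_on V nabla"
  by (auto simp: bilinear_product_on_def nabla_in_V nabla_add_left nabla_add_right
      nabla_scaleR_left nabla_scaleR_right)

lemma bilinear_neg_torsion: "bilinear_product_on V (\<lambda>X Y. - T X Y)"
  unfolding bilinear_product_on_def
proof (intro ballI conjI allI)
  fix X Y assume "X \<in> V" "Y \<in> V"
  then show "- T X Y \<in> V" by (intro neg_in_V torsion_in_V)
qed (auto simp: torsion_def nabla_add_left nabla_add_right nabla_scaleR_left nabla_scaleR_right
      lie_bracket_add_left lie_bracket_add_right lie_bracket_scaleR_left lie_bracket_scaleR_right
      algebra_simps)

lemma torsion_self: "T X X = 0"
  by (simp add: torsion_def lie_bracket_def fun_eq_iff)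

text \<open>The difference of the two associators contains \<open>nabla\<close> in the direction
  \<open>nabla X Y - nabla Y X\<close>, which is \<open>T X Y + L X Y\<close>. The \<open>L\<close>
  part completes the curvature and the \<open>T\<close> part is left over.\<close>

lemma triple_bracket_nabla:
  assumes "X \<in> V" "Y \<in> V" "Z \<in> V"
  shows "triple_bracket nabla X Y Z = R X Y Z - nabla (T X Y) Z"
  using assms
  by (simp add: triple_bracket_def associator_def curvature_def torsion_def nabla_diff_left
      nabla_in_V diff_in_V lie_bracket_in_vector_fields)

lemma torsion_neg_left: "X \<in> V \<Longrightarrow> Y \<in> V \<Longrightarrow> T (- X) Y = - T X Y"
  using lie_bracket_scaleR_left[of X Y "-1"]
  by (simp add: torsion_def nabla_neg_left nabla_neg_right)

lemma curvature_neg_left: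
  assumes "X \<in> V" "Y \<in> V" "Z \<in> V"
  shows "R (- X) Y Z = - R X Y Z"
  using assms lie_bracket_scaleR_left[of X Y "-1"]
  by (simp add: curvature_def nabla_neg_left nabla_neg_right nabla_in_V lie_bracket_in_vector_fields)

section \<open>The Bianchi identities of a connection with torsion\<close>

text \<open>In the cyclic sum on the right, the terms with a covariant derivative as direction or
  inside a bracket cancel. The curvature terms remain, together with the double brackets, which
  vanish by Jacobi.\<close>

theorem first_bianchi_identity:
  assumes "X \<in> V" "Y \<in> V" "Z \<in> V"
  shows "cyclic_sum R X Y Z
    = cyclic_sum (\<lambda>X Y Z. T (T X Y) Z + nabla_torsion nabla X Y Z) X Y Z"
proof -
  note closed = assms nabla_in_V diff_in_V lie_bracket_in_vector_fields torsion_in_V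
  have TT: "T (T A B) D = nabla (nabla A B) D - nabla (nabla B A) D - nabla (L A B) D
      - nabla D (nabla A B) + nabla D (nabla B A) + nabla D (L A B)
      - L (nabla A B) D + L (nabla B A) D + L (L A B) D"
    if "A \<in> V" "B \<in> V" "D \<in> V" for A B D
    using that
    by (simp add: torsion_def closed nabla_diff_left nabla_diff_right lie_bracket_diff_left)
  have nT: "nabla_torsion nabla D A B = nabla D (nabla A B) - nabla D (nabla B A) - nabla D (L A B)
      - nabla (nabla D A) B + nabla B (nabla D A) + L (nabla D A) B
      - nabla A (nabla D B) + nabla (nabla D B) A - L (nabla D B) A"
    if "A \<in> V" "B \<in> V" "D \<in> V" for A B D
    using that
    \<comment> \<open>Skew symmetry moves the covariant derivative into the left slot of the
      bracket, the form it has in \<open>TT\<close>.\<close>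
    by (simp add: nabla_torsion_def torsion_def closed nabla_diff_right
        lie_bracket_skew[of A "nabla D B"])
  \<comment> \<open>Jacobi is solved for one term, so that it serves as a rewrite rule.\<close>
  have "L (L X Y) Z = - (L (L Y Z) X + L (L Z X) Y)"
    using lie_bracket_jacobi[OF assms] by (simp only: eq_neg_iff_add_eq_0 add.assoc)
  then show ?thesis
    using assms by (simp add: cyclic_sum_def TT nT curvature_def)
qed

text \<open>The triple composites of covariant derivatives cancel by the Jacobi identity for
  operator commutators, and the curvatures at \<open>nabla A B\<close> cancel between
  \<open>RT\<close> and \<open>nR\<close>. After unfolding the curvatures at \<open>L A B\<close>,
  only derivatives along double brackets remain, and Jacobi for fields removes them.\<close>

theorem second_bianchi_identity:
  assumes "X \<in> V" "Y \<in> V" "Z \<in> V" "W \<in> V"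
  shows "cyclic_sum (\<lambda>X Y Z. nabla_curvature nabla X Y Z W + R (T X Y) Z W) X Y Z = 0"
proof -
  note closed = assms nabla_in_V diff_in_V lie_bracket_in_vector_fields
  have RT: "R (T A B) D W = R (nabla A B) D W - R (nabla B A) D W - R (L A B) D W"
    if "A \<in> V" "B \<in> V" "D \<in> V" for A B D
    using that
    by (simp add: curvature_def torsion_def closed nabla_diff_left nabla_diff_right
        lie_bracket_diff_left)
  have Rskew: "R A B W = - R B A W" if "A \<in> V" "B \<in> V" for A B
    using that
    by (simp add: curvature_def lie_bracket_skew[of A B] nabla_neg_left closed)
  have nR: "nabla_curvature nabla D A B W = nabla D (nabla A (nabla B W)) - nabla D (nabla B (nabla A W))
      - nabla D (nabla (L A B) W) - R (nabla D A) B W + R (nabla D B) A W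
      - nabla A (nabla B (nabla D W)) + nabla B (nabla A (nabla D W)) + nabla (L A B) (nabla D W)"
    if "A \<in> V" "B \<in> V" "D \<in> V" for A B D
    using that
    \<comment> \<open>Only curvatures in the directions \<open>A\<close>, \<open>B\<close> are
      unfolded; those at \<open>nabla D A\<close> and \<open>nabla D B\<close> stay folded to cancel
      against \<open>RT\<close>.\<close>
    by (simp add: nabla_curvature_def curvature_def[of _ A B] closed nabla_diff_right
        Rskew[of A "nabla D B"])
  have RL: "R (L A B) D W = nabla (L A B) (nabla D W) - nabla D (nabla (L A B) W) - nabla (L (L A B) D) W"
    for A B D
    by (simp add: curvature_def)
  have "nabla (L (L X Y) Z) W + nabla (L (L Y Z) X) W + nabla (L (L Z X) Y) W
      = nabla (L (L X Y) Z + L (L Y Z) X + L (L Z X) Y) W"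
    by (simp add: nabla_add_left add_in_V closed)
  also have "\<dots> = 0"
    \<comment> \<open>The instance with equal fields says that \<open>nabla 0 W\<close> is
      zero.\<close>
    using nabla_diff_left[of X X W] assms by (simp add: lie_bracket_jacobi)
  finally have "nabla (L (L X Y) Z) W = - (nabla (L (L Y Z) X) W + nabla (L (L Z X) Y) W)"
    by (simp only: eq_neg_iff_add_eq_0 add.assoc)
  then show ?thesis
    using assms by (simp add: cyclic_sum_def RT nR RL)
qed

section \<open>The connection algebra\<close>

lemma torsion_axiom_iff:
  assumes "X \<in> V" "Y \<in> V" "W \<in> V"
  shows "nabla W (- T X Y) = - T (nabla W X) Y + - T X (nabla W Y)
    \<longleftrightarrow> nabla_torsion nabla W X Y = 0"
  using assms by (auto simp: nabla_torsion_def nabla_neg_right torsion_in_V algebra_simps)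

text \<open>By \<open>triple_bracket_nabla\<close> the curvature terms assemble to
  \<open>nabla_curvature\<close>. The correction terms of axiom (iii) cancel all derivatives along
  torsion once \<open>nabla W\<close> obeys the product rule on \<open>T X Y\<close>, which is the
  assumption \<open>parallel\<close>.\<close>

lemma curvature_axiom_iff:
  assumes "X \<in> V" "Y \<in> V" "Z \<in> V" "W \<in> V"
    and parallel: "nabla_torsion nabla W X Y = 0"
  shows "nabla W (triple_bracket nabla X Y Z) =
      triple_bracket nabla (nabla W X) Y Z + triple_bracket nabla X (nabla W Y) Z
      + triple_bracket nabla X Y (nabla W Z)
      + associator nabla W (- T X Y) Z - nabla (- T X Y) (nabla W Z)
    \<longleftrightarrow> nabla_curvature nabla W X Y Z = 0"
proof -
  note closed = assms(1-4) nabla_in_V torsion_in_V curvature_in_V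
  have "nabla W (T X Y) = T (nabla W X) Y + T X (nabla W Y)"
    using parallel by (simp add: nabla_torsion_def algebra_simps)
  then have "nabla (nabla W (T X Y)) Z = nabla (T (nabla W X) Y) Z + nabla (T X (nabla W Y)) Z"
    by (simp add: nabla_add_left closed)
  then show ?thesis
    by (auto simp: triple_bracket_nabla associator_def closed nabla_neg_left nabla_neg_right
        nabla_diff_right nabla_curvature_def algebra_simps)
qed

theorem post_Lie_Yamaguti_iff_parallel:
  "post_Lie_Yamaguti_algebra V (\<lambda>X Y. - T X Y) nabla \<longleftrightarrow> locally_reductive_homogeneous M n \<A> nabla"
proof
  assume A: "post_Lie_Yamaguti_algebra V (\<lambda>X Y. - T X Y) nabla"
  \<comment> \<open>Axiom (ii) is read first, since the translation of (iii) presupposes parallel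
    torsion.\<close>
  have pT: "nabla_torsion nabla W X Y = 0" if "W \<in> V" "X \<in> V" "Y \<in> V" for W X Y
    using A that torsion_axiom_iff[of X Y W] unfolding post_Lie_Yamaguti_algebra_def by blast
  have "nabla_curvature nabla W X Y Z = 0" if "W \<in> V" "X \<in> V" "Y \<in> V" "Z \<in> V" for W X Y Z
    using A that curvature_axiom_iff[of X Y Z W] pT unfolding post_Lie_Yamaguti_algebra_def by blast
  with pT show "locally_reductive_homogeneous M n \<A> nabla"
    by (simp add: locally_reductive_homogeneous_def)
next
  assume "locally_reductive_homogeneous M n \<A> nabla"
  then have pT: "nabla_torsion nabla W X Y = 0" and pR: "nabla_curvature nabla W X Y Z = 0"
    if "W \<in> V" "X \<in> V" "Y \<in> V" "Z \<in> V" for W X Y Z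
    using that by (auto simp: locally_reductive_homogeneous_def)
  note closed = nabla_in_V torsion_in_V neg_in_V
  have iv: "cyclic_sum (\<lambda>X Y Z. triple_bracket nabla X Y Z) X Y Z =
      cyclic_sum (\<lambda>X Y Z. - T (- T X Y) Z + nabla (- T X Y) Z) X Y Z"
    if "X \<in> V" "Y \<in> V" "Z \<in> V" for X Y Z
    \<comment> \<open>Both sides contain the same derivatives along \<open>- T X Y\<close>, and the
      two signs in the iterated bracket cancel. What remains is the first Bianchi identity with
      parallel torsion.\<close>
    using first_bianchi_identity[OF that] that pT
    by (simp add: cyclic_sum_def triple_bracket_nabla torsion_neg_left nabla_neg_left closed
        algebra_simps)
  have v: "cyclic_sum (\<lambda>X Y Z. triple_bracket nabla (- T X Y) Z W) X Y Z =
      cyclic_sum (\<lambda>X Y Z. nabla (- T (- T X Y) Z) W) X Y Z"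
    if "X \<in> V" "Y \<in> V" "Z \<in> V" "W \<in> V" for X Y Z W
  proof -
    \<comment> \<open>The derivative part of the triple bracket is exactly the right-hand summand of
      (v). The two sides thus differ by a cyclic curvature sum, which the second Bianchi identity
      annihilates when the curvature is parallel.\<close>
    have "triple_bracket nabla (- T A B) D W = nabla (- T (- T A B) D) W - R (T A B) D W"
      if "A \<in> V" "B \<in> V" "D \<in> V" for A B D
      using that \<open>W \<in> V\<close>
      by (simp add: triple_bracket_nabla closed curvature_neg_left nabla_neg_left)
    then have "cyclic_sum (\<lambda>X Y Z. triple_bracket nabla (- T X Y) Z W) X Y Z =
        cyclic_sum (\<lambda>X Y Z. nabla (- T (- T X Y) Z) W) X Y Z
        - cyclic_sum (\<lambda>X Y Z. R (T X Y) Z W) X Y Z"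
      using that by (simp add: cyclic_sum_def)
    moreover have "cyclic_sum (\<lambda>X Y Z. R (T X Y) Z W) X Y Z = 0"
      using second_bianchi_identity[OF that] that pR by (simp add: cyclic_sum_def)
    ultimately show ?thesis by simp
  qed
  show "post_Lie_Yamaguti_algebra V (\<lambda>X Y. - T X Y) nabla"
    unfolding post_Lie_Yamaguti_algebra_def
    using subspace_vector_fields bilinear_neg_torsion bilinear_nabla torsion_self
      torsion_axiom_iff curvature_axiom_iff pT pR iv v
    by (intro conjI ballI) auto
qed

end

theorem proposition4p2:
  fixes M :: "'a topology" and n :: nat and \<A> :: "'a chart set"
    and nabla :: "'a vfield \<Rightarrow> 'a vfield \<Rightarrow> 'a vfield"
  assumes "smooth_manifold M n \<A>"
    and "affine_connection M n \<A> nabla"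
  shows "post_Lie_Yamaguti_algebra (vector_fields M n \<A>) (\<lambda>X Y. - torsion nabla X Y) nabla
         \<longleftrightarrow> locally_reductive_homogeneous M n \<A> nabla"
proof -
  interpret manifold_connection M n \<A> nabla
    using assms by unfold_locales (simp_all add: smooth_manifold_def)
  show ?thesis by (rule post_Lie_Yamaguti_iff_parallel)
qed

end
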